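(* Let $D>1$ be an integer. All prime $D\times D$ integer matrices that have the same determinant absolute value but different Hermite normal forms are different and pairwise co-prime. That is, if $M_1$ and $M_2$ are prime $D\times D$ integer matrices with $|\det(M_1)|=|\det(M_2)|$ whose Hermite normal forms are different, then there is no unimodular matrix $U$ with $M_1=M_2U$, and $M_1$ and $M_2$ are (left) co-prime.
   Context: All matrices are $D\times D$ with entries in $\mathbb{Z}$. A matrix is unimodular if its determinant is $1$ or $-1$, and non-unimodular otherwise. A nonsingular integer matrix $A$ is called prime if it cannot be factorized as a product of two non-unimodular integer matrices (in particular unimodular matrices count as prime). A matrix $A$ and $AU$, with $U$ unimodular, are regarded as the same matrix; "different" matrices means not the same in this sense. The Hermite normal form of a nonsingular integer matrix $A$ is the unique matrix $H=(h_{mn})$ such that $A=HU$ for some unimodular $U$, $H$ is lower triangular with positive diagonal entries, and $0\le h_{mn}<h_{mm}$ for all $1\le n<m\le D$. A nonsingular integer matrix $C$ is a left divisor of an integer matrix $M$ if $C^{-1}M$ is an integer matrix. A common left divisor (cld) of several matrices is a matrix that is a left divisor of each of them; a greatest common left divisor (gcld) is a cld $A$ such that every other cld is a left divisor of $A$. Two matrices are (left) co-prime if their gcld is unimodular. *)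

theory Defs
  imports "Jordan_Normal_Form.Gauss_Jordan_Elimination" "Jordan_Normal_Form.Determinant"
begin

definition unimodular :: "nat \<Rightarrow> int mat \<Rightarrow> bool" where
  "unimodular D U \<longleftrightarrow> U \<in> carrier_mat D D \<and> (det U = 1 \<or> det U = -1)"

(* Unimodular matrices are prime under this convention. *)
definition prime_mat :: "nat \<Rightarrow> int mat \<Rightarrow> bool" where
  "prime_mat D A \<longleftrightarrow> A \<in> carrier_mat D D \<and> det A \<noteq> 0 \<and>
     \<not> (\<exists>B \<in> carrier_mat D D. \<exists>C \<in> carrier_mat D D.
          A = B * C \<and> \<not> unimodular D B \<and> \<not> unimodular D C)"

(* Column-style form: unimodular matrices act from the right.  Indices start at 0. *)
definition is_hermite_normal_form :: "nat \<Rightarrow> int mat \<Rightarrow> int mat \<Rightarrow> bool" where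
  "is_hermite_normal_form D A H \<longleftrightarrow> H \<in> carrier_mat D D \<and>
     (\<exists>U. unimodular D U \<and> A = H * U) \<and>
     (\<forall>m < D. \<forall>n < D. m < n \<longrightarrow> H $$ (m, n) = 0) \<and>
     (\<forall>m < D. 0 < H $$ (m, m)) \<and>
     (\<forall>m < D. \<forall>n < m. 0 \<le> H $$ (m, n) \<and> H $$ (m, n) < H $$ (m, m))"

(* Meaningful for nonsingular A in carrier_mat D D, where the form exists and is unique. *)
definition hermite_normal_form :: "nat \<Rightarrow> int mat \<Rightarrow> int mat" where
  "hermite_normal_form D A = (THE H. is_hermite_normal_form D A H)"

(* The inverse is taken over the rationals; it exists since det C is nonzero. *)
definition left_divisor :: "nat \<Rightarrow> int mat \<Rightarrow> int mat \<Rightarrow> bool" where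
  "left_divisor D C M \<longleftrightarrow> C \<in> carrier_mat D D \<and> M \<in> carrier_mat D D \<and> det C \<noteq> 0 \<and>
     (\<exists>N \<in> carrier_mat D D.
        the (mat_inverse (map_mat rat_of_int C)) * map_mat rat_of_int M = map_mat rat_of_int N)"

definition common_left_divisor :: "nat \<Rightarrow> int mat \<Rightarrow> int mat set \<Rightarrow> bool" where
  "common_left_divisor D A S \<longleftrightarrow> (\<forall>M \<in> S. left_divisor D A M)"

definition greatest_common_left_divisor :: "nat \<Rightarrow> int mat \<Rightarrow> int mat set \<Rightarrow> bool" where
  "greatest_common_left_divisor D A S \<longleftrightarrow> common_left_divisor D A S \<and>
     (\<forall>B. common_left_divisor D B S \<longrightarrow> left_divisor D B A)"

(* A gcld is determined only up to right multiplication by unimodular matrices, so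
   "their gcld is unimodular" is read as: one exists, and all of them are unimodular. *)
definition left_coprime :: "nat \<Rightarrow> int mat \<Rightarrow> int mat \<Rightarrow> bool" where
  "left_coprime D M N \<longleftrightarrow>
     (\<exists>A. greatest_common_left_divisor D A {M, N}) \<and>
     (\<forall>A. greatest_common_left_divisor D A {M, N} \<longrightarrow> unimodular D A)"

end

theory Submission
  imports Defs
begin

text \<open>
  If \<open>C\<close> is a non-unimodular common left divisor, say \<open>M1 = C N1\<close> and \<open>M2 = C N2\<close>, then
  primality forces \<open>N1\<close> and \<open>N2\<close> to be unimodular, so \<open>M1 = M2 (N2\<inverse> N1)\<close> and the two matrices
  have the same Hermite normal forms. Hence all common left divisors are unimodular.
\<close>

lemma unimodular_one: "unimodular D (1\<^sub>m D)"
  by (simp add: unimodular_def)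

lemma unimodular_mult:
  assumes "unimodular D U" and "unimodular D V"
  shows "unimodular D (U * V)"
  using assms by (auto simp: unimodular_def det_mult[of _ D])

text \<open>The product of \<open>U\<close> and its adjugate, in either order, is
  \<open>det U\<close> times the identity. Since \<open>det U\<close> is its own inverse, scaling
  the adjugate by \<open>det U\<close> gives an inverse that is still integral.\<close>

lemma unimodular_inverse:
  assumes "unimodular D U"
  obtains V where "unimodular D V" and "U * V = 1\<^sub>m D" and "V * U = 1\<^sub>m D"
proof -
  have U: "U \<in> carrier_mat D D" and d: "det U * det U = 1"
    using assms by (auto simp: unimodular_def)
  define V where "V = det U \<cdot>\<^sub>m adj_mat U"
  note adj = adj_mat[OF U]
  have V: "V \<in> carrier_mat D D" using adj(1) by (simp add: V_def)
  have UV: "U * V = 1\<^sub>m D"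
    unfolding V_def mult_smult_distrib[OF U adj(1)] adj(2) using d
    by (intro eq_matI) auto
  have VU: "V * U = 1\<^sub>m D"
    unfolding V_def mult_smult_assoc_mat[OF adj(1) U] adj(3) using d
    by (intro eq_matI) auto
  have "det U * det V = 1"
    using det_mult[OF U V] UV by simp
  then have "unimodular D V"
    using assms V by (auto simp: unimodular_def)
  then show thesis using UV VU by (rule that)
qed

text \<open>Multiplying by \<open>C\<close> over the rationals clears the inverse, and the embedding
  of integer matrices into rational ones is injective. This lets all later arguments stay over the
  integers.\<close>

lemma left_divisor_iff:
  "left_divisor D C M \<longleftrightarrow> C \<in> carrier_mat D D \<and> det C \<noteq> 0 \<and> (\<exists>N \<in> carrier_mat D D. M = C * N)"
proof -
  have "(the (mat_inverse (map_mat rat_of_int C)) * map_mat rat_of_int M = map_mat rat_of_int N)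
      \<longleftrightarrow> M = C * N"
    if C: "C \<in> carrier_mat D D" and M: "M \<in> carrier_mat D D" and N: "N \<in> carrier_mat D D"
      and det: "det C \<noteq> 0" for N
  proof -
    let ?r = "map_mat rat_of_int"
    have C': "?r C \<in> carrier_mat D D" and M': "?r M \<in> carrier_mat D D"
      and N': "?r N \<in> carrier_mat D D" using C M N by auto
    have "det (?r C) \<noteq> 0" using det by simp
    \<comment> \<open>Being a unit rules out the result \<open>None\<close> of
      \<open>mat_inverse\<close>, so \<open>the\<close> returns a genuine inverse.\<close>
    then have "?r C \<in> Units (ring_mat TYPE(rat) D ())"
      by (rule det_non_zero_imp_unit[OF C'])
    then obtain B where B: "mat_inverse (?r C) = Some B"
      using mat_inverse(1)[OF C', where b = "()"] by (cases "mat_inverse (?r C)") auto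
    have CB: "?r C * B = 1\<^sub>m D" and BC: "B * ?r C = 1\<^sub>m D" and B': "B \<in> carrier_mat D D"
      using mat_inverse(2)[OF C' B] by auto
    have "B * ?r M = ?r N \<longleftrightarrow> ?r M = ?r C * ?r N"
      using assoc_mult_mat[OF C' B' M'] assoc_mult_mat[OF B' C' N'] CB BC M' N' by auto
    also have "?r C * ?r N = ?r (C * N)"
      by (rule of_int_hom.mat_hom_mult[OF C N, symmetric])
    also have "?r M = ?r (C * N) \<longleftrightarrow> M = C * N"
      by (auto dest: of_int_hom.mat_hom_inj)
    finally show ?thesis by (simp add: B)
  qed
  then show ?thesis
    unfolding left_divisor_def by auto
qed

lemma left_divisor_one: "left_divisor D (1\<^sub>m D) M \<longleftrightarrow> M \<in> carrier_mat D D"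
  by (auto simp: left_divisor_iff)

lemma unimodular_left_divisor_one:
  assumes "unimodular D U"
  shows "left_divisor D U (1\<^sub>m D)"
proof -
  obtain V where "unimodular D V" and "U * V = 1\<^sub>m D"
    using unimodular_inverse[OF assms] .
  then show ?thesis
    using assms by (auto simp: left_divisor_iff unimodular_def intro!: bexI[of _ V])
qed

text \<open>The identity is a gcld: a common left divisor is unimodular, and its integral inverse is
  the cofactor showing that it divides the identity. Every gcld is itself a common left divisor,
  hence unimodular.\<close>

lemma left_coprime_if_unimodular_divisors:
  assumes M: "M \<in> carrier_mat D D" and N: "N \<in> carrier_mat D D"
    and unim: "\<And>C. left_divisor D C M \<Longrightarrow> left_divisor D C N \<Longrightarrow> unimodular D C"
  shows "left_coprime D M N"
proof -
  have "greatest_common_left_divisor D (1\<^sub>m D) {M, N}"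
    using M N unim by (auto simp: greatest_common_left_divisor_def common_left_divisor_def
        left_divisor_one intro: unimodular_left_divisor_one)
  then show ?thesis
    using unim unfolding left_coprime_def
    by (auto simp: greatest_common_left_divisor_def common_left_divisor_def)
qed

lemma is_hermite_normal_form_mult_unimodular:
  assumes "unimodular D U" and H: "is_hermite_normal_form D A H"
  shows "is_hermite_normal_form D (A * U) H"
proof -
  obtain W where W: "unimodular D W" "A = H * W"
    using H by (auto simp: is_hermite_normal_form_def)
  have "A * U = H * (W * U)"
    using assms W by (auto simp: is_hermite_normal_form_def unimodular_def
        intro!: assoc_mult_mat)
  then show ?thesis
    using H unimodular_mult[OF W(1) assms(1)] by (auto simp: is_hermite_normal_form_def)
qed

text \<open>\<open>A\<close> and \<open>A * U\<close> satisfy \<open>is_hermite_normal_form\<close>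
  for exactly the same \<open>H\<close>, so the two \<open>THE\<close> terms denote the same
  matrix.\<close>

lemma hermite_normal_form_mult_unimodular:
  assumes U: "unimodular D U" and A: "A \<in> carrier_mat D D"
  shows "hermite_normal_form D (A * U) = hermite_normal_form D A"
proof -
  obtain V where V: "unimodular D V" and "U * V = 1\<^sub>m D"
    using unimodular_inverse[OF U] .
  \<comment> \<open>Undoing \<open>U\<close> reduces the converse direction to the same one-sided
    lemma, applied to \<open>V\<close>.\<close>
  then have "A * U * V = A"
    using assoc_mult_mat[OF A, of U D V D] U A by (auto simp: unimodular_def)
  then have "is_hermite_normal_form D (A * U) H \<longleftrightarrow> is_hermite_normal_form D A H" for H
    using is_hermite_normal_form_mult_unimodular[OF U]
      is_hermite_normal_form_mult_unimodular[OF V, of "A * U" H] by auto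
  then show ?thesis by (simp add: hermite_normal_form_def)
qed

lemma prime_mat_common_left_divisor:
  assumes M1: "prime_mat D M1" and M2: "prime_mat D M2"
    and C: "left_divisor D C M1" "left_divisor D C M2" "\<not> unimodular D C"
  shows "\<exists>U. unimodular D U \<and> M1 = M2 * U"
proof -
  obtain N1 N2 where N: "N1 \<in> carrier_mat D D" "N2 \<in> carrier_mat D D"
    and eq: "M1 = C * N1" "M2 = C * N2" and C': "C \<in> carrier_mat D D"
    using C by (auto simp: left_divisor_iff)
  \<comment> \<open>Each equation in \<open>eq\<close> factorizes a prime matrix with the
    non-unimodular left factor \<open>C\<close>, so the right factor must be unimodular.\<close>
  have U1: "unimodular D N1" and U2: "unimodular D N2"
    using M1 M2 N eq C' C(3) unfolding prime_mat_def by blast+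
  obtain V where V: "unimodular D V" and NV: "N2 * V = 1\<^sub>m D"
    using unimodular_inverse[OF U2] .
  have V': "V \<in> carrier_mat D D" using V by (simp add: unimodular_def)
  have "M2 * (V * N1) = C * (N2 * (V * N1))"
    unfolding eq using C' N V' by (intro assoc_mult_mat) auto
  also have "N2 * (V * N1) = N2 * V * N1"
    using N V' by (intro assoc_mult_mat[symmetric]) auto
  finally have "M1 = M2 * (V * N1)"
    using N by (simp add: NV eq)
  then show ?thesis using unimodular_mult[OF V U1] by blast
qed

theorem proposition4:
  fixes D :: nat and M1 M2 :: "int mat"
  assumes "D > 1"
    and "prime_mat D M1" and "prime_mat D M2"
    and "\<bar>det M1\<bar> = \<bar>det M2\<bar>"
    and "hermite_normal_form D M1 \<noteq> hermite_normal_form D M2"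
  shows "\<not> (\<exists>U. unimodular D U \<and> M1 = M2 * U) \<and> left_coprime D M1 M2"
proof
  have M: "M1 \<in> carrier_mat D D" "M2 \<in> carrier_mat D D"
    using assms(2,3) by (auto simp: prime_mat_def)
  show different: "\<not> (\<exists>U. unimodular D U \<and> M1 = M2 * U)"
    using assms(5) hermite_normal_form_mult_unimodular[OF _ M(2)] by auto
  \<comment> \<open>A non-unimodular common left divisor would yield a \<open>U\<close> that
    \<open>different\<close> excludes.\<close>
  show "left_coprime D M1 M2"
    using M prime_mat_common_left_divisor[OF assms(2,3)] different
    by (intro left_coprime_if_unimodular_divisors) blast+
qed

end
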